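(* Let $K$ be any field, let $n\ge 1$, let $f\in\mathrm{Aut}(K)$, let $B$ be any invertible matrix in $\mathrm{M}_n(K)$, and let $\beta:\mathrm{M}_n(K)\to\mathrm{M}_n(K)$ be the function defined by $\beta(X)=BX_fB^{-1}$ for all $X\in\mathrm{M}_n(K)$. Then the kernel of $I_n-(\beta(S))^{n-1}\beta(E_{n,1})\in\mathrm{M}_n(K)$ contains a nonzero vector, and for every nonzero vector $\mathbf{b}\in K^n$ in this kernel, the matrix $$\overline{B}=\left[(\beta(S))^{n-1}\beta(E_{n,1})\mathbf{b}\mid(\beta(S))^{n-2}\beta(E_{n,1})\mathbf{b}\mid\cdots\mid\beta(S)\beta(E_{n,1})\mathbf{b}\mid\beta(E_{n,1})\mathbf{b}\right]\in\mathrm{M}_n(K)$$ is invertible and $$\beta(X)=\overline{B}X_f\overline{B}^{-1}$$ for all $X\in\mathrm{M}_n(K)$.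
   Context: $\mathrm{Aut}(K)$ is the group of field automorphisms of $K$. For $X=[x_{i,j}]\in\mathrm{M}_n(K)$ and $f\in\mathrm{Aut}(K)$, $X_f=[f(x_{i,j})]$ is the matrix obtained by applying $f$ entrywise. $E_{i,j}$ is the standard matrix unit with $1$ in position $(i,j)$ and zeros elsewhere, $I_n$ is the identity matrix, and $S=E_{1,2}+E_{2,3}+\cdots+E_{n-1,n}$. Vectors are columns, and the bars in $\overline{B}$ separate its $n$ columns: for $1\le k\le n$ the $k$-th column is $(\beta(S))^{n-k}\beta(E_{n,1})\mathbf{b}$ (with zeroth powers equal to $I_n$). *)

theory Defs
  imports "Jordan_Normal_Form.Matrix_Kernel"
begin

text \<open>
  Row and column indices of \<^typ>\<open>'a mat\<close> start at \<open>0\<close>. The indices \<open>i\<close>, \<open>j\<close> of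
  \<open>mat_unit n i j\<close> start at \<open>1\<close>, so that \<open>mat_unit n n 1\<close> has its entry \<open>1\<close> in the
  lower left corner.
\<close>

definition mat_unit :: "nat \<Rightarrow> nat \<Rightarrow> nat \<Rightarrow> 'a :: field mat" where
  "mat_unit n i j = mat n n (\<lambda>(r, c). if Suc r = i \<and> Suc c = j then 1 else 0)"

definition shift_mat :: "nat \<Rightarrow> 'a :: field mat" where
  "shift_mat n = finsum (ring_mat TYPE('a) n ()) (\<lambda>i. mat_unit n i (i + 1)) {1..<n}"

text \<open>Only meaningful for invertible \<open>A\<close>, where \<open>mat_inverse A\<close> is not \<open>None\<close>.\<close>

definition mat_inv :: "'a :: field mat \<Rightarrow> 'a mat" where
  "mat_inv A = the (mat_inverse A)"

definition bar_mat :: "nat \<Rightarrow> ('a mat \<Rightarrow> 'a mat) \<Rightarrow> 'a vec \<Rightarrow> 'a :: field mat" where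
  "bar_mat n \<beta> b =
     mat_of_cols n (map (\<lambda>k. (\<beta> (shift_mat n) ^\<^sub>m (n - k) * \<beta> (mat_unit n n 1)) *\<^sub>v b) [1..<n + 1])"

lemma mat_unit_carrier [simp]: "mat_unit n i j \<in> carrier_mat n n"
  by (simp add: mat_unit_def)

lemma shift_mat_eq:
  "(shift_mat n :: 'a :: field mat) = mat n n (\<lambda>(r, c). if c = Suc r then 1 else 0)"
proof -
  interpret R: ring "ring_mat TYPE('a) n ()" by (rule ring_mat)
  have "finsum (ring_mat TYPE('a) n ()) (\<lambda>i. mat_unit n i (i + 1)) {1..<Suc m}
      = mat n n (\<lambda>(r, c). if r < m \<and> c = Suc r then 1 else 0)" for m
  proof (induction m)
    case 0
    show ?case by (simp add: ring_mat_simps) (auto intro!: eq_matI)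
  next
    case (Suc m)
    have "{1..<Suc (Suc m)} = insert (Suc m) {1..<Suc m}" by auto
    then have "finsum (ring_mat TYPE('a) n ()) (\<lambda>i. mat_unit n i (i + 1)) {1..<Suc (Suc m)}
       = mat_unit n (Suc m) (Suc m + 1) +
         finsum (ring_mat TYPE('a) n ()) (\<lambda>i. mat_unit n i (i + 1)) {1..<Suc m}"
      by (simp add: R.finsum_insert ring_mat_simps Pi_def)
    also have "\<dots> = mat n n (\<lambda>(r, c). if r < Suc m \<and> c = Suc r then 1 else 0)"
      unfolding Suc.IH by (auto intro!: eq_matI simp: mat_unit_def)
    finally show ?case .
  qed
  from this[of "n - 1"] show ?thesis
    unfolding shift_mat_def by (cases n) (auto intro!: eq_matI)
qed

lemma mat_inv:
  assumes "A \<in> carrier_mat n n" and "invertible_mat A"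
  shows "mat_inv A \<in> carrier_mat n n" "A * mat_inv A = 1\<^sub>m n" "mat_inv A * A = 1\<^sub>m n"
proof -
  from assms obtain B where AB: "A * B = 1\<^sub>m n" and BA: "B * A = 1\<^sub>m (dim_row B)"
    by (auto simp: invertible_mat_def inverts_mat_def)
  from arg_cong[OF AB, of dim_col] arg_cong[OF BA, of dim_col] assms(1)
  have B: "B \<in> carrier_mat n n" by auto
  have "A \<in> Units (ring_mat TYPE('a) n ())"
    using AB BA B assms(1) by (auto simp: Units_def ring_mat_simps)
  then obtain C where "mat_inverse A = Some C"
    using mat_inverse(1)[OF assms(1), where b = "()"] by (cases "mat_inverse A") auto
  with mat_inverse(2)[OF assms(1) this]
  show "mat_inv A \<in> carrier_mat n n" "A * mat_inv A = 1\<^sub>m n" "mat_inv A * A = 1\<^sub>m n"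
    by (auto simp: mat_inv_def)
qed

end

theory Submission
  imports Defs
begin

text \<open>
  Since \<open>f\<close> fixes \<open>0\<close> and \<open>1\<close>, \<open>\<beta>\<close> sends \<open>S\<close> and \<open>E\<^sub>n\<^sub>1\<close> to their conjugates by \<open>B\<close>. With \<open>c\<close> the
  first entry of \<open>B\<^sup>-\<^sup>1 b\<close>, the vector \<open>\<beta>(S)\<^sup>m \<beta>(E\<^sub>n\<^sub>1) b\<close> is therefore \<open>c\<close> times column \<open>n - m\<close> of \<open>B\<close>.
  For \<open>m = n - 1\<close>, the kernel in question is the line spanned by the first column of \<open>B\<close>, and for
  nonzero \<open>b\<close> in it the barred matrix is \<open>c B\<close> with \<open>c \<noteq> 0\<close>; the scalar cancels in the conjugation.
\<close>

lemma shift_mat_carrier [simp]: "shift_mat n \<in> carrier_mat n n"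
  by (simp add: shift_mat_eq)

lemma map_mat_unit:
  assumes "f 0 = 0" "f 1 = 1"
  shows "map_mat f (mat_unit n i j) = mat_unit n i j"
  using assms by (auto simp: mat_unit_def)

lemma map_shift_mat:
  assumes "f 0 = 0" "f 1 = 1"
  shows "map_mat f (shift_mat n) = shift_mat n"
  using assms by (auto simp: shift_mat_eq)

lemma mat_unit_mult_vec:
  assumes "w \<in> carrier_vec n" "n \<ge> 1"
  shows "mat_unit n n 1 *\<^sub>v w = w $ 0 \<cdot>\<^sub>v unit_vec n (n - 1)"
proof (rule eq_vecI)
  fix i assume "i < dim_vec (w $ 0 \<cdot>\<^sub>v unit_vec n (n - 1))"
  then have i: "i < n" by simp
  have "(mat_unit n n 1 *\<^sub>v w) $ i = (\<Sum>k<n. (if Suc i = n \<and> k = 0 then 1 else 0) * w $ k)"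
    using i assms by (auto simp: mat_unit_def scalar_prod_def atLeast0LessThan intro!: sum.cong)
  \<comment> \<open>Nesting the conditionals isolates \<open>k = 0\<close>, a form in which the sum
    collapses to its single surviving term.\<close>
  also have "\<dots> = (\<Sum>k<n. if k = 0 then (if Suc i = n then w $ k else 0) else 0)"
    by (intro sum.cong) auto
  also have "\<dots> = (w $ 0 \<cdot>\<^sub>v unit_vec n (n - 1)) $ i"
    using i assms by auto
  finally show "(mat_unit n n 1 *\<^sub>v w) $ i = (w $ 0 \<cdot>\<^sub>v unit_vec n (n - 1)) $ i" .
qed (simp add: mat_unit_def)

lemma shift_mat_mult_unit_vec:
  assumes "Suc j < n"
  shows "shift_mat n *\<^sub>v unit_vec n (Suc j) = unit_vec n j"
  using assms by (intro eq_vecI) (auto simp: shift_mat_eq)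

text \<open>The power unfolds with its extra factor on the right, so one shift acts first and lowers
  the index by one; the form \<open>j + m\<close> keeps the induction free of subtraction.\<close>

lemma shift_mat_pow_mult_unit_vec:
  "j + m < n \<Longrightarrow>
    shift_mat n ^\<^sub>m m *\<^sub>v unit_vec n (j + m) = (unit_vec n j :: 'a :: field vec)"
proof (induction m)
  case 0
  show ?case by (simp add: shift_mat_eq)
next
  case (Suc m)
  then show ?case
    by (simp add: assoc_mult_mat_vec[of _ n n _ n] pow_carrier_mat shift_mat_mult_unit_vec)
qed

lemma pow_mat_conj:
  fixes A :: "'a :: field mat"
  assumes "A \<in> carrier_mat n n" "B \<in> carrier_mat n n" "C \<in> carrier_mat n n"
    and "B * C = 1\<^sub>m n" "C * B = 1\<^sub>m n"
  shows "(B * A * C) ^\<^sub>m m = B * A ^\<^sub>m m * C"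
proof -
  have "similar_mat_wit (B * A * C) A B C"
    using assms by (auto simp: similar_mat_wit_def Let_def)
  from similar_mat_wit_pow[OF this] show ?thesis
    by (auto simp: similar_mat_wit_def Let_def)
qed

text \<open>Uniqueness of inverses: it identifies the value chosen by \<open>mat_inverse\<close>
  with an explicitly given inverse.\<close>

lemma mat_inv_eqI:
  assumes A: "A \<in> carrier_mat n n" and D: "D \<in> carrier_mat n n"
    and AD: "A * D = 1\<^sub>m n" and DA: "D * A = 1\<^sub>m n"
  shows "invertible_mat A" "mat_inv A = D"
proof -
  show inv: "invertible_mat A"
    using assms by (auto simp: invertible_mat_def inverts_mat_def)
  note I = mat_inv[OF A inv]
  have "mat_inv A = D * A * mat_inv A" using I DA by simp
  also have "\<dots> = D * (A * mat_inv A)" using A D I by (intro assoc_mult_mat)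
  also have "\<dots> = D" using D I by simp
  finally show "mat_inv A = D" .
qed

lemma mat_inv_smult:
  assumes A: "A \<in> carrier_mat n n" "invertible_mat A" and c: "c \<noteq> 0"
  shows "invertible_mat (c \<cdot>\<^sub>m A)" "mat_inv (c \<cdot>\<^sub>m A) = inverse c \<cdot>\<^sub>m mat_inv A"
proof -
  note I = mat_inv[OF A]
  have 1: "c \<cdot>\<^sub>m A * (inverse c \<cdot>\<^sub>m mat_inv A) = 1\<^sub>m n"
    using A(1) I c
    by (auto simp: mult_smult_assoc_mat[of _ n n _ n] mult_smult_distrib[of _ n n _ n])
  have 2: "inverse c \<cdot>\<^sub>m mat_inv A * (c \<cdot>\<^sub>m A) = 1\<^sub>m n"
    using A(1) I c
    by (auto simp: mult_smult_assoc_mat[of _ n n _ n] mult_smult_distrib[of _ n n _ n])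
  show "invertible_mat (c \<cdot>\<^sub>m A)" "mat_inv (c \<cdot>\<^sub>m A) = inverse c \<cdot>\<^sub>m mat_inv A"
    using mat_inv_eqI[OF _ _ 1 2] A(1) I(1) by auto
qed

text \<open>Read from the right: \<open>C\<close> gives coordinates in the basis of columns of
  \<open>B\<close>, the matrix unit moves the first coordinate to the last place, the shifts carry
  it up \<open>m\<close> places, and \<open>B\<close> turns the resulting basis vector into a
  column.\<close>

lemma conj_shift_pow_mult_vec:
  fixes B :: "'a :: field mat"
  assumes "B \<in> carrier_mat n n" "C \<in> carrier_mat n n" "B * C = 1\<^sub>m n" "C * B = 1\<^sub>m n"
    and v: "v \<in> carrier_vec n" and m: "m < n"
  shows "((B * shift_mat n * C) ^\<^sub>m m * (B * mat_unit n n 1 * C)) *\<^sub>v v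
    = (C *\<^sub>v v) $ 0 \<cdot>\<^sub>v col B (n - 1 - m)"
proof -
  let ?S = "shift_mat n :: 'a mat" and ?E = "mat_unit n n 1 :: 'a mat"
  note [simp] = assms(1,2) v
  have Cv: "C *\<^sub>v v \<in> carrier_vec n" by (rule mult_mat_vec_carrier[of _ n n]) simp_all
  have P: "?S ^\<^sub>m m \<in> carrier_mat n n" by (simp add: pow_carrier_mat)
  have EC: "?E *\<^sub>v (C *\<^sub>v v) \<in> carrier_vec n"
    by (rule mult_mat_vec_carrier[OF mat_unit_carrier Cv])
  \<comment> \<open>This cancels the inner \<open>C\<close> and \<open>B\<close> where the two
    conjugates meet.\<close>
  have CB: "C *\<^sub>v (B *\<^sub>v w) = w" if "w \<in> carrier_vec n" for w
    using assms that by (simp flip: assoc_mult_mat_vec[of _ n n _ n])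
  have "((B * ?S * C) ^\<^sub>m m * (B * ?E * C)) *\<^sub>v v
      = (B * ?S ^\<^sub>m m * C * (B * ?E * C)) *\<^sub>v v"
    by (simp only: pow_mat_conj[OF shift_mat_carrier assms(1-4)])
  also have "\<dots> = B *\<^sub>v (?S ^\<^sub>m m *\<^sub>v (?E *\<^sub>v (C *\<^sub>v v)))"
    using P Cv EC CB
    by (simp add: assoc_mult_mat_vec[of _ n n _ n] mult_carrier_mat[of _ n n _ n]
        mult_mat_vec_carrier[of _ n n])
  also have "?E *\<^sub>v (C *\<^sub>v v) = (C *\<^sub>v v) $ 0 \<cdot>\<^sub>v unit_vec n (n - 1)"
    using m by (intro mat_unit_mult_vec Cv) simp
  also have "?S ^\<^sub>m m *\<^sub>v \<dots> = (C *\<^sub>v v) $ 0 \<cdot>\<^sub>v unit_vec n (n - 1 - m)"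
  proof -
    have "?S ^\<^sub>m m *\<^sub>v unit_vec n (n - 1) = unit_vec n (n - 1 - m)"
      using m shift_mat_pow_mult_unit_vec[where 'a = 'a, of "n - 1 - m" m n] by simp
    then show ?thesis using P by (simp add: mult_mat_vec[of _ n n])
  qed
  also have "B *\<^sub>v \<dots> = (C *\<^sub>v v) $ 0 \<cdot>\<^sub>v col B (n - 1 - m)"
    using m carrier_matD[OF assms(1)] by (auto simp: mult_mat_vec[of _ n n] intro!: eq_vecI)
  finally show ?thesis .
qed

text \<open>Recasts the kernel as a set of fixed vectors, so that a formula for the action of
  \<open>M\<close> on vectors can be applied directly.\<close>

lemma mem_mat_kernel_one_minus_iff:
  fixes M :: "'a :: field mat"
  assumes M: "M \<in> carrier_mat n n"
  shows "v \<in> mat_kernel (1\<^sub>m n - M) \<longleftrightarrow> v \<in> carrier_vec n \<and> M *\<^sub>v v = v"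
proof -
  have "(1\<^sub>m n - M) *\<^sub>v v = 0\<^sub>v n \<longleftrightarrow> M *\<^sub>v v = v" if v: "v \<in> carrier_vec n"
  proof -
    have Mv: "M *\<^sub>v v \<in> carrier_vec n" using M v by simp
    have "(1\<^sub>m n - M) *\<^sub>v v = v - M *\<^sub>v v"
      using M v by (simp add: minus_mult_distrib_mat_vec[of _ n n])
    then show ?thesis using v Mv by (auto simp: vec_eq_iff)
  qed
  then show ?thesis using M by (auto simp: mat_kernel_def)
qed

theorem proposition4p1:
  fixes f :: "'a :: field \<Rightarrow> 'a"
    and n :: nat
    and B :: "'a mat"
    and \<beta> :: "'a mat \<Rightarrow> 'a mat"
  assumes "n \<ge> 1"
    and "field_isom f"
    and "B \<in> carrier_mat n n" and "invertible_mat B"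
    and "\<And>X. X \<in> carrier_mat n n \<Longrightarrow> \<beta> X = B * map_mat f X * mat_inv B"
  shows "(\<exists>v \<in> mat_kernel (1\<^sub>m n - \<beta> (shift_mat n) ^\<^sub>m (n - 1) * \<beta> (mat_unit n n 1)). v \<noteq> 0\<^sub>v n)
    \<and> (\<forall>b \<in> mat_kernel (1\<^sub>m n - \<beta> (shift_mat n) ^\<^sub>m (n - 1) * \<beta> (mat_unit n n 1)). b \<noteq> 0\<^sub>v n \<longrightarrow>
         invertible_mat (bar_mat n \<beta> b) \<and>
         (\<forall>X \<in> carrier_mat n n. \<beta> X = bar_mat n \<beta> b * map_mat f X * mat_inv (bar_mat n \<beta> b)))"
proof -
  interpret f: field_isom f by fact
  note n = \<open>n \<ge> 1\<close> and B = \<open>B \<in> carrier_mat n n\<close>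
  define C where "C = mat_inv B"
  note C = mat_inv[OF assms(3,4), folded C_def]
  have \<beta>S: "\<beta> (shift_mat n) = B * shift_mat n * C"
    by (simp add: assms(5) map_shift_mat C_def)
  have \<beta>E: "\<beta> (mat_unit n n 1) = B * mat_unit n n 1 * C"
    by (simp add: assms(5) map_mat_unit C_def)
  define M where "M m = \<beta> (shift_mat n) ^\<^sub>m m * \<beta> (mat_unit n n 1)" for m
  have M: "M m \<in> carrier_mat n n" for m
    unfolding M_def \<beta>S \<beta>E using B C(1) by (auto intro!: pow_carrier_mat mult_carrier_mat)
  have Mv: "M m *\<^sub>v v = (C *\<^sub>v v) $ 0 \<cdot>\<^sub>v col B (n - 1 - m)"
    if "v \<in> carrier_vec n" "m < n" for v m
    unfolding M_def \<beta>S \<beta>E using conj_shift_pow_mult_vec[OF B C that] .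
  \<comment> \<open>With \<open>m = n - 1\<close> the column index \<open>n - 1 - m\<close> is
    0.\<close>
  have ker: "v \<in> mat_kernel (1\<^sub>m n - M (n - 1)) \<longleftrightarrow>
      v \<in> carrier_vec n \<and> (C *\<^sub>v v) $ 0 \<cdot>\<^sub>v col B 0 = v" for v
    using n by (auto simp: mem_mat_kernel_one_minus_iff[OF M] Mv)

  have colB: "col B 0 \<in> carrier_vec n" using B by (intro carrier_vecI) simp
  \<comment> \<open>The witness is the first column of \<open>B\<close>: since \<open>C * B\<close>
    is the identity, its image under \<open>C\<close> is the first unit vector, with first entry 1.
    This makes it a fixed vector and also shows it is nonzero, because \<open>C\<close> sends 0 to
    0.\<close>
  have "C *\<^sub>v col B 0 = col (C * B) 0"
    using B C(1) n by (subst col_mult2[of _ n n _ n]) auto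
  then have "(C *\<^sub>v col B 0) $ 0 = 1"
    using C(3) n by simp
  then have "(C *\<^sub>v col B 0) $ 0 \<cdot>\<^sub>v col B 0 = col B 0" "col B 0 \<noteq> 0\<^sub>v n"
    using n C(1) by auto
  with colB have ex: "\<exists>v \<in> mat_kernel (1\<^sub>m n - M (n - 1)). v \<noteq> 0\<^sub>v n"
    unfolding ker Bex_def by blast

  have "invertible_mat (bar_mat n \<beta> b) \<and>
      (\<forall>X \<in> carrier_mat n n. \<beta> X = bar_mat n \<beta> b * map_mat f X * mat_inv (bar_mat n \<beta> b))"
    if b: "b \<in> mat_kernel (1\<^sub>m n - M (n - 1))" and b0: "b \<noteq> 0\<^sub>v n" for b
  proof -
    define c where "c = (C *\<^sub>v b) $ 0"
    have bc: "b \<in> carrier_vec n" and bB: "c \<cdot>\<^sub>v col B 0 = b"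
      using b unfolding ker c_def by auto
    have "b = 0\<^sub>v n" if "c = 0"
      using B unfolding bB[symmetric] that by (intro eq_vecI) auto
    with b0 have c: "c \<noteq> 0" by blast
    have bar: "bar_mat n \<beta> b = c \<cdot>\<^sub>m B"
    proof -
      have "bar_mat n \<beta> b = mat_of_cols n (map (\<lambda>k. M (n - k) *\<^sub>v b) [1..<n + 1])"
        by (simp add: bar_mat_def M_def)
      \<comment> \<open>The exponent \<open>n - k\<close> yields column
        \<open>n - 1 - (n - k) = k - 1\<close>, which is the \<open>k\<close>-th column when
        counting from 1.\<close>
      also have "map (\<lambda>k. M (n - k) *\<^sub>v b) [1..<n + 1] = map (\<lambda>k. c \<cdot>\<^sub>v col B (k - 1)) [1..<n + 1]"
        by (rule map_cong[OF refl]) (auto simp: Mv bc c_def)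
      also have "mat_of_cols n \<dots> = c \<cdot>\<^sub>m B"
        using B by (intro eq_matI) (auto simp: mat_of_cols_index simp del: upt_Suc)
      finally show ?thesis .
    qed
    \<comment> \<open>The inverse of the barred matrix is thus \<open>inverse c\<close> times
      \<open>C\<close>, so the two scalars cancel in the conjugation below.\<close>
    note I = mat_inv_smult[OF assms(3,4) c, folded bar C_def]
    have "\<beta> X = bar_mat n \<beta> b * map_mat f X * mat_inv (bar_mat n \<beta> b)"
      if X: "X \<in> carrier_mat n n" for X
    proof -
      have "bar_mat n \<beta> b * map_mat f X * mat_inv (bar_mat n \<beta> b)
          = c \<cdot>\<^sub>m B * map_mat f X * (inverse c \<cdot>\<^sub>m C)"
        by (simp add: I(2) bar[symmetric])
      also have "\<dots> = B * map_mat f X * C"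
        using B C(1) X c
        by (auto simp: mult_smult_assoc_mat[of _ n n _ n] mult_smult_distrib[of _ n n _ n])
      finally show ?thesis using X by (simp add: assms(5) C_def)
    qed
    with I(1) show ?thesis by blast
  qed
  with ex show ?thesis unfolding M_def by blast
qed

end
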